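(* Let $G$ be a finite simple graph of order $n$. Then $\alpha_1'(G) \ge 0$, with equality if and only if $G \cong tK_2 \cup (n-2t)K_1$ for some integer $t \ge 0$.
   Context: All graphs are finite, simple and undirected. For a graph $G$, a $1$-nearly edge independent set of $G$ is a set $M \subseteq E(G)$ such that $M$ contains exactly one (unordered) pair of distinct edges that are adjacent in $G$ (i.e. share a common end vertex). The $1$-nearly edge independence number $\alpha_1'(G)$ is the maximum cardinality of a $1$-nearly edge independent set of $G$, taken to be $0$ if $G$ has no such set. $K_m$ denotes the complete graph on $m$ vertices, $tH$ denotes the disjoint union of $t$ copies of a graph $H$, and $\cup$ denotes disjoint union of graphs. *)

theory Defs
  imports Main
begin

text \<open>A graph is a pair of a vertex set and a set of edges, each edge being the set of its two
  end vertices. The null graph is allowed.\<close>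

type_synonym 'a graph = "'a set \<times> 'a set set"

abbreviation verts :: "'a graph \<Rightarrow> 'a set" where
  "verts G \<equiv> fst G"

abbreviation edges :: "'a graph \<Rightarrow> 'a set set" where
  "edges G \<equiv> snd G"

definition simple_graph :: "'a graph \<Rightarrow> bool" where
  "simple_graph G \<longleftrightarrow> finite (verts G) \<and> (\<forall>e\<in>edges G. e \<subseteq> verts G \<and> card e = 2)"

definition graph_order :: "'a graph \<Rightarrow> nat" where
  "graph_order G = card (verts G)"

definition graph_iso :: "'a graph \<Rightarrow> 'b graph \<Rightarrow> bool" (infix "\<cong>\<^sub>g" 50) where
  "G \<cong>\<^sub>g H \<longleftrightarrow>
     (\<exists>f. bij_betw f (verts G) (verts H) \<and>
          (\<forall>u\<in>verts G. \<forall>v\<in>verts G. {u, v} \<in> edges G \<longleftrightarrow> {f u, f v} \<in> edges H))"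

definition complete_graph :: "nat \<Rightarrow> nat graph" where
  "complete_graph m = ({..<m}, {{u, v} |u v. u < m \<and> v < m \<and> u \<noteq> v})"

definition graph_copies :: "nat \<Rightarrow> 'a graph \<Rightarrow> (nat \<times> 'a) graph" where
  "graph_copies t H =
     ({..<t} \<times> verts H, {Pair i ` e |i e. i < t \<and> e \<in> edges H})"

definition graph_disjoint_union :: "'a graph \<Rightarrow> 'b graph \<Rightarrow> ('a + 'b) graph" where
  "graph_disjoint_union G H =
     (Inl ` verts G \<union> Inr ` verts H, (`) Inl ` edges G \<union> (`) Inr ` edges H)"

definition adjacent_pairs :: "'a set set \<Rightarrow> 'a set set set" where
  "adjacent_pairs M = {{e, f} |e f. e \<in> M \<and> f \<in> M \<and> e \<noteq> f \<and> e \<inter> f \<noteq> {}}"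

definition one_nearly_edge_independent :: "'a graph \<Rightarrow> 'a set set \<Rightarrow> bool" where
  "one_nearly_edge_independent G M \<longleftrightarrow> M \<subseteq> edges G \<and> card (adjacent_pairs M) = 1"

definition one_nearly_edge_independence_number :: "'a graph \<Rightarrow> nat" where
  "one_nearly_edge_independence_number G =
     (if \<exists>M. one_nearly_edge_independent G M
      then Max {card M |M. one_nearly_edge_independent G M} else 0)"

end

theory Submission
  imports Defs
begin

text \<open>Two distinct adjacent edges already form a 1-nearly edge independent set, so the number
  vanishes exactly when the edges are pairwise disjoint. Such a graph consists of single edges and
  isolated vertices: enumerating the edges, their end points and the uncovered vertices maps the
  model graph onto it, and a count shows that this surjection is a bijection.\<close>

lemma simple_graph_finite_edges:
  assumes "simple_graph G"
  shows "finite (edges G)"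
proof (rule finite_subset)
  show "edges G \<subseteq> Pow (verts G)" and "finite (Pow (verts G))"
    using assms by (auto simp: simple_graph_def)
qed

text \<open>The only unordered pair of distinct members of a two-element family is the family
  itself, so exactly one adjacency occurs.\<close>

lemma one_nearly_edge_independent_pair:
  assumes "e \<in> edges G" "f \<in> edges G" "e \<noteq> f" "e \<inter> f \<noteq> {}"
  shows "one_nearly_edge_independent G {e, f}"
proof -
  have "adjacent_pairs {e, f} = {{e, f}}"
    using assms(3,4) unfolding adjacent_pairs_def by blast
  then show ?thesis
    using assms(1,2) by (simp add: one_nearly_edge_independent_def)
qed

lemma one_nearly_edge_independence_number_eq_0_iff:
  assumes "simple_graph G"
  shows "one_nearly_edge_independence_number G = 0 \<longleftrightarrow> pairwise disjnt (edges G)"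
proof
  assume zero: "one_nearly_edge_independence_number G = 0"
  show "pairwise disjnt (edges G)"
  proof (rule ccontr)
    assume "\<not> pairwise disjnt (edges G)"
    then obtain e f where ef: "e \<in> edges G" "f \<in> edges G" "e \<noteq> f" "e \<inter> f \<noteq> {}"
      by (auto simp: pairwise_def disjnt_def)
    let ?C = "{card M |M. one_nearly_edge_independent G M}"
    have ind: "one_nearly_edge_independent G {e, f}"
      by (rule one_nearly_edge_independent_pair[OF ef])
    \<comment> \<open>\<open>Max\<close> bounds its elements only on a finite set; finiteness of the
      edge set supplies this.\<close>
    have "?C \<subseteq> card ` Pow (edges G)"
      by (auto simp: one_nearly_edge_independent_def)
    then have "finite ?C"
      by (rule finite_subset) (simp add: simple_graph_finite_edges[OF assms])
    moreover have "card {e, f} \<in> ?C"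
      using ind by blast
    ultimately have "card {e, f} \<le> Max ?C"
      by (rule Max_ge)
    \<comment> \<open>Since \<open>{e, f}\<close> is a witness, the value 0 comes from the
      \<open>Max\<close> branch and not from the default. This contradicts the cardinality 2 of
      \<open>{e, f}\<close>.\<close>
    moreover have "Max ?C = 0"
      using zero ind by (auto simp: one_nearly_edge_independence_number_def split: if_splits)
    ultimately show False
      using ef(3) by simp
  qed
next
  assume "pairwise disjnt (edges G)"
  then have "adjacent_pairs M = {}" if "M \<subseteq> edges G" for M
    using that unfolding adjacent_pairs_def pairwise_def disjnt_def by blast
  \<comment> \<open>No adjacent pairs means a count of 0 rather than 1, so no subset of the edges
    qualifies and the default value 0 applies.\<close>
  then have "\<not> one_nearly_edge_independent G M" for M
    by (auto simp: one_nearly_edge_independent_def)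
  then show "one_nearly_edge_independence_number G = 0"
    by (simp add: one_nearly_edge_independence_number_def)
qed

text \<open>Two edges of \<open>G\<close> that meet in \<open>a\<close> have the form
  \<open>{a, b}\<close> and \<open>{a, c}\<close>. Their images share \<open>f a\<close>, so
  disjointness in \<open>H\<close> forces them to coincide, and injectivity of \<open>f\<close>
  gives \<open>b = c\<close>.\<close>

lemma graph_iso_pairwise_disjnt_edges:
  assumes "simple_graph G" "G \<cong>\<^sub>g H" "pairwise disjnt (edges H)"
  shows "pairwise disjnt (edges G)"
proof (rule pairwiseI, rule ccontr)
  fix e e'
  assume e: "e \<in> edges G" "e' \<in> edges G" "e \<noteq> e'" and "\<not> disjnt e e'"
  then obtain a where a: "a \<in> e" "a \<in> e'"
    by (auto simp: disjnt_def)
  obtain f where bij: "bij_betw f (verts G) (verts H)"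
    and hom: "\<And>u v. u \<in> verts G \<Longrightarrow> v \<in> verts G \<Longrightarrow> {u, v} \<in> edges G \<longleftrightarrow> {f u, f v} \<in> edges H"
    using assms(2) unfolding graph_iso_def by blast
  have end_vertex: "\<exists>b. d = {a, b}" if "a \<in> d" "d \<in> edges G" for d
  proof -
    have "card d = 2"
      using that assms(1) by (auto simp: simple_graph_def)
    then show ?thesis
      using that(1) by (auto simp: card_2_iff)
  qed
  obtain b c where bc: "e = {a, b}" "e' = {a, c}"
    using end_vertex[OF a(1) e(1)] end_vertex[OF a(2) e(2)] by blast
  have V: "a \<in> verts G" "b \<in> verts G" "c \<in> verts G"
    using e(1,2) assms(1) bc by (auto simp: simple_graph_def)
  have "{f a, f b} \<in> edges H" "{f a, f c} \<in> edges H"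
    using hom V e(1,2) bc by auto
  then have "{f a, f b} = {f a, f c}"
    using pairwiseD[OF assms(3), of "{f a, f b}" "{f a, f c}"]
    by (intro ccontr[of "{f a, f b} = {f a, f c}"]) (simp add: disjnt_def)
  then have "f b = f c"
    by (auto simp: doubleton_eq_iff)
  then have "b = c"
    using bij V by (auto simp: bij_betw_def dest: inj_onD)
  then show False
    using bc e(3) by simp
qed

text \<open>The natural map goes from the model to the graph, whereas the isomorphism is wanted in
  the other direction, hence the inverse of \<open>f\<close>. Since \<open>f\<close> is injective on
  \<open>verts H\<close>, a set of vertices of \<open>H\<close> is determined by its image, so
  non-edges are respected too.\<close>

lemma graph_iso_if_bij_image_edges:
  assumes bij: "bij_betw f (verts H) (verts G)"
    and edges: "edges G = (`) f ` edges H"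
    and sub: "\<And>e. e \<in> edges H \<Longrightarrow> e \<subseteq> verts H"
  shows "G \<cong>\<^sub>g H"
  unfolding graph_iso_def
proof (intro exI conjI ballI)
  let ?g = "inv_into (verts H) f"
  show bij': "bij_betw ?g (verts G) (verts H)"
    by (rule bij_betw_inv_into[OF bij])
  fix u v
  assume uv: "u \<in> verts G" "v \<in> verts G"
  have g: "?g u \<in> verts H" "?g v \<in> verts H"
    using bij' uv by (auto simp: bij_betw_def)
  have "f ` {?g u, ?g v} = {u, v}"
    using bij_betw_inv_into_right[OF bij] uv by simp
  then have "{u, v} \<in> edges G \<longleftrightarrow> (\<exists>e\<in>edges H. f ` e = f ` {?g u, ?g v})"
    unfolding edges by auto
  also have "\<dots> \<longleftrightarrow> {?g u, ?g v} \<in> edges H"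
  proof -
    have "f ` e = f ` {?g u, ?g v} \<longleftrightarrow> e = {?g u, ?g v}" if "e \<in> edges H" for e
      by (rule inj_on_image_eq_iff[OF bij_betw_imp_inj_on[OF bij] sub[OF that]]) (use g in simp)
    then show ?thesis
      by auto
  qed
  finally show "{u, v} \<in> edges G \<longleftrightarrow> {?g u, ?g v} \<in> edges H" .
qed

text \<open>The ends of the \<open>i\<close>-th edge are \<open>Inl (i, 0)\<close> and
  \<open>Inl (i, 1)\<close>; the \<open>k\<close>-th isolated vertex is
  \<open>Inr (k, 0)\<close>.\<close>

definition matching_graph :: "nat \<Rightarrow> nat \<Rightarrow> (nat \<times> nat + nat \<times> nat) graph" where
  "matching_graph t m =
     graph_disjoint_union (graph_copies t (complete_graph 2)) (graph_copies m (complete_graph 1))"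

lemma verts_matching_graph:
  "verts (matching_graph t m) = Inl ` ({..<t} \<times> {..<2}) \<union> Inr ` ({..<m} \<times> {..<1})"
  by (simp add: matching_graph_def graph_disjoint_union_def graph_copies_def complete_graph_def)

lemma edges_matching_graph:
  "edges (matching_graph t m) = (\<lambda>i. {Inl (i, 0), Inl (i, 1)}) ` {..<t}"
proof -
  have "edges (complete_graph 1) = {}"
    by (auto simp: complete_graph_def)
  moreover have "edges (complete_graph 2) = {{0, 1}}"
  proof -
    have "{{u, v} |u v. u < 2 \<and> v < 2 \<and> u \<noteq> (v::nat)} = {{0, 1}}" (is "?E = _")
    proof (rule set_eqI, rule iffI)
      fix e
      assume "e \<in> ?E"
      then obtain u v where "e = {u, v}" "u < 2" "v < 2" "u \<noteq> v"
        by blast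
      then show "e \<in> {{0, 1}}"
        by (auto simp: less_2_cases_iff)
    next
      fix e :: "nat set"
      assume "e \<in> {{0, 1}}"
      then have "e = {0, 1} \<and> 0 < (2::nat) \<and> 1 < (2::nat) \<and> 0 \<noteq> (1::nat)"
        by simp
      then show "e \<in> ?E"
        by blast
    qed
    then show ?thesis
      by (simp add: complete_graph_def)
  qed
  ultimately have "edges (matching_graph t m) =
      (`) Inl ` {Pair i ` e |i e. i < t \<and> e \<in> {{0, 1}}}"
    by (simp add: matching_graph_def graph_disjoint_union_def graph_copies_def)
  also have "{Pair i ` e |i e. i < t \<and> e \<in> {{0, 1}}} = (\<lambda>i. {(i, 0), (i, 1)}) ` {..<t}"
    by auto
  finally show ?thesis
    by (simp add: image_image)
qed

lemma graph_iso_matching_graph_if_pairwise_disjnt_edges: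
  assumes G: "simple_graph G" and disj: "pairwise disjnt (edges G)"
  defines "t \<equiv> card (edges G)"
  shows "2 * t \<le> graph_order G" "G \<cong>\<^sub>g matching_graph t (graph_order G - 2 * t)"
proof -
  let ?U = "\<Union> (edges G)"
  let ?m = "graph_order G - 2 * t"
  have fin: "finite (verts G)" and sub: "?U \<subseteq> verts G"
    and card2: "\<And>e. e \<in> edges G \<Longrightarrow> card e = 2"
    using G by (auto simp: simple_graph_def)
  \<comment> \<open>Each edge is finite because an infinite set would have \<open>card\<close> 0
    instead of 2.\<close>
  have "card ?U = (\<Sum>e\<in>edges G. card e)"
    by (rule card_Union_disjoint[OF disj]) (use card2 card.infinite in fastforce)
  then have card_U: "card ?U = 2 * t"
    by (simp add: card2 t_def)
  then show le: "2 * t \<le> graph_order G"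
    using card_mono[OF fin sub] by (simp add: graph_order_def)
  obtain d where d: "bij_betw d {..<t} (edges G)"
    using ex_bij_betw_nat_finite[OF simple_graph_finite_edges[OF G]]
    by (auto simp: t_def atLeast0LessThan)
  have "\<forall>i\<in>{..<t}. \<exists>a b. d i = {a, b}"
    using card2 d by (metis bij_betwE card_2_iff)
  then obtain a b where ab: "\<And>i. i < t \<Longrightarrow> d i = {a i, b i}"
    by (metis lessThan_iff)
  have "card (verts G - ?U) = ?m"
    using card_Diff_subset[OF finite_subset[OF sub fin] sub] card_U
    by (simp add: graph_order_def)
  then obtain h where h: "bij_betw h {..<?m} (verts G - ?U)"
    using ex_bij_betw_nat_finite[of "verts G - ?U"] fin by (auto simp: atLeast0LessThan)
  \<comment> \<open>The two vertices of the \<open>i\<close>-th copy of K_2 go to the ends of the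
    edge \<open>d i\<close>, and the \<open>k\<close>-th isolated vertex goes to the
    \<open>k\<close>-th vertex outside all edges.\<close>
  define f where "f = case_sum (\<lambda>(i, j). if j = (0::nat) then a i else b i) (\<lambda>(k, j::nat). h k)"
  let ?H = "matching_graph t ?m"
  have edges: "edges G = (`) f ` edges ?H"
  proof -
    have "edges G = d ` {..<t}"
      using d by (simp add: bij_betw_def)
    also have "\<dots> = (\<lambda>i. {a i, b i}) ` {..<t}"
      using ab by auto
    finally show ?thesis
      by (simp add: edges_matching_graph image_image f_def)
  qed
  have pairs: "{..<t} \<times> {..<2::nat} = (\<lambda>i. (i, 0)) ` {..<t} \<union> (\<lambda>i. (i, 1)) ` {..<t}"
    by (auto simp: less_2_cases_iff)
  have "f ` verts ?H = a ` {..<t} \<union> b ` {..<t} \<union> h ` {..<?m}"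
    unfolding verts_matching_graph pairs by (force simp: f_def image_Un image_image)
  also have "a ` {..<t} \<union> b ` {..<t} = ?U"
    unfolding edges by (auto simp: edges_matching_graph f_def)
  also have "?U \<union> h ` {..<?m} = verts G"
    using h sub by (auto simp: bij_betw_def)
  finally have surj: "f ` verts ?H = verts G" .
  \<comment> \<open>Injectivity comes from counting instead of a case analysis. By \<open>le\<close>
    the truncated subtraction is exact, so the model has as many vertices as \<open>G\<close>, and a
    surjection between finite sets of equal size is injective.\<close>
  have "card (verts ?H) = 2 * t + ?m"
    unfolding verts_matching_graph
    by (subst card_Un_disjoint) (auto simp: card_image card_cartesian_product)
  then have "card (verts ?H) = card (f ` verts ?H)"
    using le surj by (simp add: graph_order_def)
  moreover have "finite (verts ?H)"
    by (simp add: verts_matching_graph)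
  ultimately have "inj_on f (verts ?H)"
    by (simp add: eq_card_imp_inj_on)
  then have "bij_betw f (verts ?H) (verts G)"
    using surj by (simp add: bij_betw_def)
  then show "G \<cong>\<^sub>g ?H"
    using edges by (rule graph_iso_if_bij_image_edges)
      (auto simp: edges_matching_graph verts_matching_graph)
qed

theorem theorem3p1:
  fixes G :: "'a graph" and n :: nat
  assumes "simple_graph G" and "graph_order G = n"
  shows "one_nearly_edge_independence_number G \<ge> 0 \<and>
    (one_nearly_edge_independence_number G = 0 \<longleftrightarrow>
      (\<exists>t::nat. 2 * t \<le> n \<and>
        G \<cong>\<^sub>g graph_disjoint_union (graph_copies t (complete_graph 2))
                                 (graph_copies (n - 2 * t) (complete_graph 1))))"
proof -
  \<comment> \<open>Edges from different copies of K_2 differ in the first coordinate of all their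
    vertices.\<close>
  have "pairwise disjnt (edges (matching_graph t m))" for t m
    by (auto simp: edges_matching_graph pairwise_def disjnt_def)
  then have "pairwise disjnt (edges G) \<longleftrightarrow>
      (\<exists>t. 2 * t \<le> n \<and> G \<cong>\<^sub>g matching_graph t (n - 2 * t))"
    using graph_iso_matching_graph_if_pairwise_disjnt_edges[OF assms(1)]
      graph_iso_pairwise_disjnt_edges[OF assms(1)] assms(2)
    by blast
  \<comment> \<open>The bound by 0 is immediate, the number being a natural number.\<close>
  then show ?thesis
    unfolding matching_graph_def[symmetric]
    by (simp add: one_nearly_edge_independence_number_eq_0_iff[OF assms(1)])
qed

end
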